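(* Let $(V,V^+)$ be an ordered $*$-vector space with order unit $e$, assume $V\neq\{0\}$, and let $\|\cdot\|$ denote the order seminorm on $V_h$. For $v\in V$ let $$\|v\|_m := \sup \{ |f(v)|: f:V \to \mathbb{C} \text{ is a state} \}.$$ The following are true: (1) $\|\cdot\|_m$ is a $*$-seminorm on the complex $*$-vector space $V$; (2) $\|v\|_m=\|v\|$ for all $v \in V_h$; and (3) if $|||\cdot|||$ is any other $*$-seminorm on the complex vector space $V$ such that $|||v||| = \|v\|$ for every $v \in V_h$, then $\|v\|_m \leq |||v|||$ for every $v \in V$.
   Context: A $*$-vector space is a complex vector space $V$ with a conjugate-linear involution $*:V\to V$; $V_h:=\{x\in V: x^*=x\}$. An ordered $*$-vector space $(V,V^+)$ is a $*$-vector space $V$ with a nonempty subset $V^+\subseteq V_h$ closed under addition and under multiplication by scalars in $[0,\infty)$, such that $V^+\cap -V^+=\{0\}$. For $v,w\in V_h$ write $v\ge w$ if $v-w\in V^+$. An element $e\in V_h$ is an order unit if for every $x\in V_h$ there is a real $r>0$ with $re\ge x$. A state on $V$ is a $\mathbb{C}$-linear functional $f:V\to\mathbb{C}$ with $f(V^+)\subseteq[0,\infty)$ and $f(e)=1$. The order seminorm on $V_h$ is $\|v\|:=\inf\{r\in\mathbb{R}: re+v\ge0\text{ and }re-v\ge0\}$. A $*$-seminorm on $V$ is a (complex) seminorm $|||\cdot|||$ on $V$ with $|||v^*|||=|||v|||$ for all $v\in V$. *)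

theory Defs
  imports "HOL-Analysis.Analysis"
begin

text \<open>
  The complex vector space \<open>V\<close> is the universe of an arbitrary type \<open>'a\<close>, with scalar
  multiplication \<open>smul\<close> given by the library locale \<open>vector_space\<close> over the field of
  complex numbers.
\<close>

locale star_vector_space = vector_space smul
  for smul :: "complex \<Rightarrow> 'a::ab_group_add \<Rightarrow> 'a" +
  fixes star :: "'a \<Rightarrow> 'a"
  assumes star_star: "star (star x) = x"
    and star_add: "star (x + y) = star x + star y"
    and star_scale: "star (smul c x) = smul (cnj c) (star x)"

definition hermitian_part :: "('a \<Rightarrow> 'a) \<Rightarrow> 'a set"
  where "hermitian_part star = {x. star x = x}"

locale ordered_star_vector_space = star_vector_space smul star
  for smul :: "complex \<Rightarrow> 'a::ab_group_add \<Rightarrow> 'a" and star :: "'a \<Rightarrow> 'a" +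
  fixes P :: "'a set"
  assumes cone_nonempty: "P \<noteq> {}"
    and cone_hermitian: "P \<subseteq> hermitian_part star"
    and cone_add: "x \<in> P \<Longrightarrow> y \<in> P \<Longrightarrow> x + y \<in> P"
    and cone_scale: "0 \<le> r \<Longrightarrow> x \<in> P \<Longrightarrow> smul (complex_of_real r) x \<in> P"
    and cone_proper: "P \<inter> uminus ` P = {0}"

definition cone_ge :: "'a::ab_group_add set \<Rightarrow> 'a \<Rightarrow> 'a \<Rightarrow> bool"
  where "cone_ge P v w \<longleftrightarrow> v - w \<in> P"

definition order_unit ::
    "(complex \<Rightarrow> 'a::ab_group_add \<Rightarrow> 'a) \<Rightarrow> ('a \<Rightarrow> 'a) \<Rightarrow> 'a set \<Rightarrow> 'a \<Rightarrow> bool"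
  where "order_unit smul star P e \<longleftrightarrow>
    e \<in> hermitian_part star \<and>
    (\<forall>x \<in> hermitian_part star. \<exists>r::real. r > 0 \<and> cone_ge P (smul (complex_of_real r) e) x)"

definition state ::
    "(complex \<Rightarrow> 'a::ab_group_add \<Rightarrow> 'a) \<Rightarrow> 'a set \<Rightarrow> 'a \<Rightarrow> ('a \<Rightarrow> complex) \<Rightarrow> bool"
  where "state smul P e f \<longleftrightarrow>
    Vector_Spaces.linear smul ((*) :: complex \<Rightarrow> complex \<Rightarrow> complex) f \<and>
    f ` P \<subseteq> \<real>\<^sub>\<ge>\<^sub>0 \<and> f e = 1"

text \<open>Only meaningful for \<open>v\<close> in \<open>hermitian_part star\<close>.\<close>

definition order_seminorm ::
    "(complex \<Rightarrow> 'a::ab_group_add \<Rightarrow> 'a) \<Rightarrow> 'a set \<Rightarrow> 'a \<Rightarrow> 'a \<Rightarrow> real"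
  where "order_seminorm smul P e v =
    Inf {r::real. cone_ge P (smul (complex_of_real r) e + v) 0 \<and>
                  cone_ge P (smul (complex_of_real r) e - v) 0}"

definition star_seminorm ::
    "(complex \<Rightarrow> 'a::ab_group_add \<Rightarrow> 'a) \<Rightarrow> ('a \<Rightarrow> 'a) \<Rightarrow> ('a \<Rightarrow> real) \<Rightarrow> bool"
  where "star_seminorm smul star N \<longleftrightarrow>
    (\<forall>v. 0 \<le> N v) \<and>
    (\<forall>v w. N (v + w) \<le> N v + N w) \<and>
    (\<forall>c v. N (smul c v) = cmod c * N v) \<and>
    (\<forall>v. N (star v) = N v)"

definition state_values ::
    "(complex \<Rightarrow> 'a::ab_group_add \<Rightarrow> 'a) \<Rightarrow> 'a set \<Rightarrow> 'a \<Rightarrow> 'a \<Rightarrow> real set"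
  where "state_values smul P e v = {cmod (f v) | f. state smul P e f}"

text \<open>
  \<open>Sup\<close> on the reals is the genuine supremum only for a nonempty set that is bounded above, so
  a statement about \<open>minimal_seminorm\<close> should assert these properties of \<open>state_values\<close> too.
\<close>

definition minimal_seminorm ::
    "(complex \<Rightarrow> 'a::ab_group_add \<Rightarrow> 'a) \<Rightarrow> 'a set \<Rightarrow> 'a \<Rightarrow> 'a \<Rightarrow> real"
  where "minimal_seminorm smul P e v = Sup (state_values smul P e v)"

end

theory Submission
  imports Defs
begin

text \<open>
  The point is to produce enough states. Write \<open>gauge v\<close> for the infimum of all real \<open>r\<close> such
  that \<open>r e\<close> dominates the hermitian part of \<open>v\<close>. Since \<open>e\<close> is an order unit and \<open>-e\<close> is not
  positive (otherwise \<open>V = {0}\<close>), this is a finite-valued sublinear functional on \<open>V\<close> regarded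
  as a real vector space. By the Hahn-Banach theorem, for each hermitian \<open>h\<close> some real-linear
  \<open>g \<le> gauge\<close> satisfies \<open>g h = gauge h\<close>; being dominated by the gauge makes \<open>g\<close> positive and
  normalised, and \<open>f v = g v - \<i> g (\<i> v)\<close> is a state with \<open>f h = gauge h\<close>
  (\<open>exists_state_eq_gauge\<close>).

  On hermitian \<open>h\<close> every state satisfies \<open>\<bar>f h\<bar> \<le> \<parallel>h\<parallel>\<close>, while the order seminorm is at
  most \<open>max (gauge h) (gauge (-h))\<close> and both of these numbers are attained up to sign by states;
  hence the supremum over states is the order seminorm there. For minimality, let \<open>f\<close> be a state
  and rotate \<open>v\<close> by a complex \<open>c\<close> of modulus one so that \<open>f (c v) = \<bar>f v\<bar>\<close>. States commute
  with the involutions, so \<open>\<bar>f v\<bar>\<close> is the value of \<open>f\<close> at the hermitian part of \<open>c v\<close>. There a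
  competing seminorm \<open>N\<close> agrees with the order seminorm, and passing to the hermitian part does
  not increase \<open>N\<close>, so \<open>\<bar>f v\<bar> \<le> N (c v) = N v\<close>.

  The Hahn-Banach theorem is proved here without extending functionals from subspaces: by Zorn's
  lemma there is a minimal sublinear functional below a given one, and minimal sublinear
  functionals are linear.
\<close>

section \<open>Sublinear functionals and linear functionals below them\<close>

text \<open>
  The scalar multiplication is a parameter rather than that of a type class, because the functionals
  below live on a complex vector space with its scalars restricted to the reals. Positive homogeneity
  includes the scalar zero, so \<open>p 0 = 0\<close>.
\<close>

definition sublinear :: "(real \<Rightarrow> 'a::ab_group_add \<Rightarrow> 'a) \<Rightarrow> ('a \<Rightarrow> real) \<Rightarrow> bool"
  where "sublinear scl p \<longleftrightarrow>
    (\<forall>x y. p (x + y) \<le> p x + p y) \<and> (\<forall>r x. 0 \<le> r \<longrightarrow> p (scl r x) = r * p x)"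

text \<open>
  The functional \<open>tilt scl p x\<close> is the largest sublinear functional below \<open>p\<close> whose value at \<open>-x\<close>
  is at most \<open>- p x\<close>: any linear functional below it agrees with \<open>p\<close> at \<open>x\<close>.
\<close>

definition tilt :: "(real \<Rightarrow> 'a::ab_group_add \<Rightarrow> 'a) \<Rightarrow> ('a \<Rightarrow> real) \<Rightarrow> 'a \<Rightarrow> 'a \<Rightarrow> real"
  where "tilt scl p x y = (INF t\<in>{0..}. p (y + scl t x) - t * p x)"

lemma le_cInf_add:
  fixes A B :: "real set"
  assumes "A \<noteq> {}" "B \<noteq> {}" "\<And>a b. a \<in> A \<Longrightarrow> b \<in> B \<Longrightarrow> x \<le> a + b"
  shows "x \<le> Inf A + Inf B"
proof -
  have "x - a \<le> Inf B" if "a \<in> A" for a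
    using assms(2) by (rule cInf_greatest) (use assms(3) that in \<open>force simp: diff_le_eq add.commute\<close>)
  then have "x - Inf B \<le> Inf A"
    using assms(1) by (intro cInf_greatest) (auto simp: algebra_simps)
  then show ?thesis by simp
qed

lemma le_mult_cInf:
  fixes A :: "real set"
  assumes "A \<noteq> {}" "0 < r" "\<And>a. a \<in> A \<Longrightarrow> x \<le> r * a"
  shows "x \<le> r * Inf A"
proof -
  have "x / r \<le> Inf A"
    using assms by (intro cInf_greatest) (auto simp: field_simps)
  then show ?thesis using assms(2) by (simp add: field_simps)
qed

text \<open>
  For positive scalars one inequality suffices; the other follows by applying it to the inverse.
\<close>

lemma sublinearI:
  fixes scl :: "real \<Rightarrow> 'a::ab_group_add \<Rightarrow> 'a"
  assumes "vector_space scl"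
    and add: "\<And>x y. p (x + y) \<le> p x + p y"
    and zero: "p 0 = 0"
    and scl: "\<And>r x. 0 < r \<Longrightarrow> p (scl r x) \<le> r * p x"
  shows "sublinear scl p"
proof -
  interpret vector_space scl by fact
  have "p (scl r x) = r * p x" if "0 \<le> r" for r x
  proof (cases "r = 0")
    case True
    then show ?thesis by (simp add: zero)
  next
    case False
    with that have r: "0 < r" by simp
    have "p (scl (inverse r) (scl r x)) \<le> inverse r * p (scl r x)"
      using r by (intro scl) simp
    then have "r * p x \<le> p (scl r x)" using r by (simp add: field_simps)
    with scl[OF r, of x] show ?thesis by simp
  qed
  with add show ?thesis by (simp add: sublinear_def)
qed

lemma sublinear_scale: "sublinear scl p \<Longrightarrow> 0 \<le> r \<Longrightarrow> p (scl r x) = r * p x"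
  unfolding sublinear_def by blast

lemma sublinear_zero:
  assumes "vector_space scl" "sublinear scl p"
  shows "p 0 = 0"
proof -
  interpret vector_space scl by fact
  have "p (scl 0 0) = 0 * p 0" using assms(2) unfolding sublinear_def by blast
  then show ?thesis by simp
qed

lemma sublinear_ge_uminus:
  assumes "vector_space scl" "sublinear scl p"
  shows "- p (- x) \<le> p x"
proof -
  have "p (x + - x) \<le> p x + p (- x)" using assms(2) unfolding sublinear_def by blast
  then show ?thesis using sublinear_zero[OF assms] by simp
qed

text \<open>The inequality \<open>- p (- y) \<le> p (y + t x) - t p x\<close> shows that the infimum is finite.\<close>

lemma tilt_le:
  fixes scl :: "real \<Rightarrow> 'a::ab_group_add \<Rightarrow> 'a"
  assumes "vector_space scl" "sublinear scl p" "0 \<le> t"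
  shows "tilt scl p x y \<le> p (y + scl t x) - t * p x"
proof -
  have "- p (- y) \<le> p (y + scl s x) - s * p x" if "0 \<le> s" for s
  proof -
    have "p (scl s x) = s * p x"
      using assms(2) that unfolding sublinear_def by blast
    moreover have "p ((y + scl s x) + - y) \<le> p (y + scl s x) + p (- y)"
      using assms(2) unfolding sublinear_def by blast
    ultimately show ?thesis by simp
  qed
  then have "bdd_below ((\<lambda>s. p (y + scl s x) - s * p x) ` {0..})"
    by (intro bdd_belowI[where m = "- p (- y)"]) auto
  then show ?thesis
    unfolding tilt_def using assms(3) by (intro cINF_lower) auto
qed

lemma sublinear_tilt:
  fixes scl :: "real \<Rightarrow> 'a::ab_group_add \<Rightarrow> 'a"
  assumes vs: "vector_space scl" and p: "sublinear scl p"
  shows "sublinear scl (tilt scl p x)"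
proof (rule sublinearI[OF vs])
  interpret vector_space scl by fact
  fix y z
  show "tilt scl p x (y + z) \<le> tilt scl p x y + tilt scl p x z"
    unfolding tilt_def[of _ _ _ y] tilt_def[of _ _ _ z]
  proof (rule le_cInf_add)
    fix a b
    assume "a \<in> (\<lambda>t. p (y + scl t x) - t * p x) ` {0..}"
      and "b \<in> (\<lambda>t. p (z + scl t x) - t * p x) ` {0..}"
    then obtain s t where s: "0 \<le> s" "a = p (y + scl s x) - s * p x"
      and t: "0 \<le> t" "b = p (z + scl t x) - t * p x" by auto
    have "tilt scl p x (y + z) \<le> p (y + z + scl (s + t) x) - (s + t) * p x"
      using s t by (intro tilt_le[OF vs p]) simp
    also have "y + z + scl (s + t) x = (y + scl s x) + (z + scl t x)"
      by (simp add: scale_left_distrib)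
    also have "p \<dots> \<le> p (y + scl s x) + p (z + scl t x)"
      using p unfolding sublinear_def by blast
    finally show "tilt scl p x (y + z) \<le> a + b"
      using s t by (simp add: algebra_simps)
  qed auto
next
  have "p (0 + scl t x) - t * p x = 0" if "t \<in> {0..}" for t
    using p that unfolding sublinear_def by simp
  then have "(\<lambda>t. p (0 + scl t x) - t * p x) ` {0..} = {0}" by (auto intro!: image_eqI[where x = 0])
  then show "tilt scl p x 0 = 0" unfolding tilt_def by simp
next
  interpret vector_space scl by fact
  fix r :: real and y
  assume r: "0 < r"
  show "tilt scl p x (scl r y) \<le> r * tilt scl p x y"
    unfolding tilt_def[of _ _ _ y]
  proof (rule le_mult_cInf)
    fix a
    assume "a \<in> (\<lambda>t. p (y + scl t x) - t * p x) ` {0..}"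
    then obtain t where t: "0 \<le> t" "a = p (y + scl t x) - t * p x" by auto
    have "tilt scl p x (scl r y) \<le> p (scl r y + scl (r * t) x) - (r * t) * p x"
      using r t by (intro tilt_le[OF vs p]) simp
    also have "scl r y + scl (r * t) x = scl r (y + scl t x)"
      by (simp add: scale_right_distrib)
    also have "p \<dots> = r * p (y + scl t x)"
      using p r unfolding sublinear_def by simp
    finally show "tilt scl p x (scl r y) \<le> r * a"
      unfolding t(2) by (simp add: algebra_simps)
  qed (use r in auto)
qed

lemma exists_minimal_sublinear:
  fixes scl :: "real \<Rightarrow> 'a::ab_group_add \<Rightarrow> 'a"
  assumes vs: "vector_space scl" and q: "sublinear scl q"
  obtains p where "sublinear scl p" "p \<le> q" "\<And>p'. sublinear scl p' \<Longrightarrow> p' \<le> p \<Longrightarrow> p' = p"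
proof -
  define S where "S = {p. sublinear scl p \<and> p \<le> q}"
  have "\<exists>m\<in>S. \<forall>a\<in>S. m \<ge> a \<longrightarrow> a = m"
  proof (rule predicate_Zorn)
    show "partial_order_on S (relation_of (\<lambda>x y. y \<le> x) S)"
      by (intro partial_order_on_relation_ofI) auto
  next
    fix C
    assume "C \<in> Chains (relation_of (\<lambda>x y. y \<le> x) S)"
    then have CS: "C \<subseteq> S" and chain: "\<And>f g. f \<in> C \<Longrightarrow> g \<in> C \<Longrightarrow> f \<le> g \<or> g \<le> f"
      unfolding Chains_def relation_of_def by auto
    show "\<exists>u\<in>S. \<forall>a\<in>C. u \<le> a"
    proof (cases "C = {}")
      case True
      with q show ?thesis unfolding S_def by auto
    next
      case False
      define u where "u x = (INF f\<in>C. f x)" for x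
      have lower: "u x \<le> f x" if "f \<in> C" for f x
      proof -
        \<comment> \<open>This bound is uniform in \<open>C\<close>, so the pointwise infimum is finite.\<close>
        have "- q (- x) \<le> g x" if "g \<in> C" for g
        proof -
          have "sublinear scl g" "g (- x) \<le> q (- x)"
            using that CS unfolding S_def by (auto simp: le_fun_def)
          with sublinear_ge_uminus[OF vs, of g x] show ?thesis by linarith
        qed
        then have "bdd_below ((\<lambda>g. g x) ` C)"
          by (intro bdd_belowI[where m = "- q (- x)"]) auto
        then show ?thesis unfolding u_def using that by (intro cINF_lower) auto
      qed
      have "sublinear scl u"
      proof (rule sublinearI[OF vs])
        fix x y
        show "u (x + y) \<le> u x + u y"
          unfolding u_def[of x] u_def[of y]
        proof (rule le_cInf_add)
          fix a b assume "a \<in> (\<lambda>f. f x) ` C" "b \<in> (\<lambda>f. f y) ` C"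
          then obtain f g where f: "f \<in> C" "a = f x" and g: "g \<in> C" "b = g y" by auto
          \<comment> \<open>\<open>C\<close> is a chain, so one sublinear functional lies below both \<open>f\<close> and \<open>g\<close>.\<close>
          obtain h where h: "h \<in> C" "h \<le> f" "h \<le> g" using chain[OF f(1) g(1)] f g by blast
          have "u (x + y) \<le> h (x + y)" by (rule lower[OF h(1)])
          also have "\<dots> \<le> h x + h y" using h(1) CS unfolding S_def sublinear_def by blast
          also have "\<dots> \<le> a + b" using h f g by (simp add: le_fun_def add_mono)
          finally show "u (x + y) \<le> a + b" .
        qed (use False in auto)
      next
        have "f 0 = 0" if "f \<in> C" for f
          using that CS sublinear_zero[OF vs] unfolding S_def by auto
        then have "(\<lambda>f. f 0) ` C = {0}" using False by force
        then show "u 0 = 0" unfolding u_def by simp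
      next
        fix r :: real and x
        assume r: "0 < r"
        show "u (scl r x) \<le> r * u x"
          unfolding u_def[of x]
        proof (rule le_mult_cInf)
          fix a assume "a \<in> (\<lambda>f. f x) ` C"
          then obtain f where f: "f \<in> C" "a = f x" by auto
          have "f (scl r x) = r * f x"
            using f CS r unfolding S_def sublinear_def by auto
          with lower[OF f(1), of "scl r x"] f show "u (scl r x) \<le> r * a" by simp
        qed (use False r in auto)
      qed
      moreover have "u \<le> q"
      proof -
        obtain f where "f \<in> C" using False by auto
        then have "u \<le> f" "f \<le> q" using lower CS unfolding S_def by (auto simp: le_fun_def)
        then show ?thesis by (rule order_trans)
      qed
      ultimately show ?thesis using lower unfolding S_def by (auto simp: le_fun_def)
    qed
  qed
  then obtain m where m: "m \<in> S" "\<And>a. a \<in> S \<Longrightarrow> a \<le> m \<Longrightarrow> a = m" by blast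
  show thesis
  proof (rule that)
    show "sublinear scl m" "m \<le> q" using m(1) unfolding S_def by auto
    fix p' assume "sublinear scl p'" "p' \<le> m"
    then show "p' = m" using m unfolding S_def by (auto intro: order_trans)
  qed
qed

lemma linear_minimal_sublinear:
  fixes scl :: "real \<Rightarrow> 'a::ab_group_add \<Rightarrow> 'a"
  assumes vs: "vector_space scl" and p: "sublinear scl p"
    and min: "\<And>p'. sublinear scl p' \<Longrightarrow> p' \<le> p \<Longrightarrow> p' = p"
  shows "Vector_Spaces.linear scl (*) p"
proof -
  interpret vector_space scl by fact
  have add: "p (y + x) = p y + p x" for x y
  proof (rule antisym)
    have "tilt scl p x \<le> p"
      using tilt_le[OF vs p, of 0 x] by (simp add: le_fun_def)
    \<comment> \<open>Minimality makes tilting trivial; the term \<open>t = 1\<close> of the infimum gives superadditivity.\<close>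
    then have "tilt scl p x = p" by (intro min sublinear_tilt vs p)
    with tilt_le[OF vs p, of 1 x y] show "p y + p x \<le> p (y + x)" by simp
  qed (use p in \<open>simp add: sublinear_def\<close>)
  have neg: "p (- x) = - p x" for x
    using add[of "- x" x] sublinear_zero[OF vs p] by simp
  have "p (scl r x) = r * p x" for r x
  proof (cases "0 \<le> r")
    case True
    then show ?thesis using p unfolding sublinear_def by blast
  next
    case False
    then have "p (scl (- r) x) = - r * p x" by (intro sublinear_scale[OF p]) simp
    then show ?thesis by (simp add: neg)
  qed
  then show ?thesis
    using add vs by (auto simp: Vector_Spaces.linear_iff vector_space_def algebra_simps)
qed

text \<open>
  Hahn-Banach theorem: a sublinear functional dominates a linear one that touches it at a
  prescribed point.
\<close>

theorem sublinear_dominates_linear: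
  fixes scl :: "real \<Rightarrow> 'a::ab_group_add \<Rightarrow> 'a"
  assumes vs: "vector_space scl" and q: "sublinear scl q"
  obtains g where "Vector_Spaces.linear scl (*) g" "\<And>x. g x \<le> q x" "g x0 = q x0"
proof -
  interpret vector_space scl by fact
  obtain g where g: "sublinear scl g" "g \<le> tilt scl q x0"
    and min: "\<And>p'. sublinear scl p' \<Longrightarrow> p' \<le> g \<Longrightarrow> p' = g"
    using exists_minimal_sublinear[OF vs sublinear_tilt[OF vs q, of x0]] by blast
  have lin: "Vector_Spaces.linear scl (*) g"
    by (rule linear_minimal_sublinear[OF vs g(1) min])
  have le: "g x \<le> q x" for x
    using g(2) tilt_le[OF vs q, of 0 x0 x] by (force simp: le_fun_def intro: order_trans)
  have "g (- x0) \<le> tilt scl q x0 (- x0)" using g(2) by (simp add: le_fun_def)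
  also have "\<dots> \<le> - q x0"
    using tilt_le[OF vs q, of 1 x0 "- x0"] sublinear_zero[OF vs q] by simp
  finally have "q x0 \<le> g x0"
    using sublinear_ge_uminus[OF vs g(1), of x0] by simp
  with le[of x0] have "g x0 = q x0" by simp
  with lin le that show thesis by blast
qed


section \<open>Order unit spaces and their states\<close>

text \<open>A nonzero ordered \<open>*\<close>-vector space with a chosen order unit \<open>e\<close>.\<close>

locale order_unit_space = ordered_star_vector_space smul star P
  for smul :: "complex \<Rightarrow> 'a::ab_group_add \<Rightarrow> 'a" and star :: "'a \<Rightarrow> 'a" and P :: "'a set" +
  fixes e :: 'a
  assumes unit: "order_unit smul star P e"
    and nontrivial: "(UNIV :: 'a set) \<noteq> {0}"
begin

abbreviation rsmul :: "real \<Rightarrow> 'a \<Rightarrow> 'a"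
  where "rsmul r \<equiv> smul (complex_of_real r)"

text \<open>
  The hermitian part \<open>(v + v\<^sup>*) / 2\<close>. The second hermitian component of \<open>v\<close> is
  \<open>herm (- \<i> v)\<close>, so that \<open>v = herm v + \<i> herm (- \<i> v)\<close>.
\<close>

definition herm :: "'a \<Rightarrow> 'a"
  where "herm v = rsmul (1/2) (v + star v)"

text \<open>
  Taking hermitian parts defines the gauge on all of \<open>V\<close>, so that no real subspace has to be
  handled as a carrier set.
\<close>

definition upper_bounds :: "'a \<Rightarrow> real set"
  where "upper_bounds v = {r. rsmul r e - herm v \<in> P}"

text \<open>
  The infimum is finite: an order unit gives upper bounds, and these are bounded below because
  \<open>-e\<close> is not positive (\<open>upper_bounds_nonempty\<close>, \<open>bdd_below_upper_bounds\<close>).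
\<close>

definition gauge :: "'a \<Rightarrow> real"
  where "gauge v = Inf (upper_bounds v)"

lemma vector_space_rsmul: "vector_space rsmul"
  by unfold_locales (simp_all add: scale_right_distrib scale_left_distrib)

lemma star_zero [simp]: "star 0 = 0"
  using star_add[of 0 0] by simp

lemma star_uminus: "star (- x) = - star x"
  using star_add[of x "- x"] by (simp add: minus_unique)

lemma double_half: "rsmul (1/2) (x + x) = x"
  by (simp add: scale_right_distrib flip: scale_left_distrib)

lemma star_herm: "star (herm v) = herm v"
  unfolding herm_def by (simp add: star_scale star_add star_star add.commute)

lemma herm_star: "herm (star v) = herm v"
  unfolding herm_def by (simp add: star_star add.commute)

lemma herm_hermitian: "star v = v \<Longrightarrow> herm v = v"
  unfolding herm_def by (simp only: double_half)

lemma herm_zero [simp]: "herm 0 = 0"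
  by (simp add: herm_def)

lemma herm_add: "herm (x + y) = herm x + herm y"
  unfolding herm_def by (simp add: star_add scale_right_distrib algebra_simps)

lemma herm_scale: "herm (rsmul r x) = rsmul r (herm x)"
  unfolding herm_def by (simp add: star_scale mult.commute flip: scale_right_distrib)

lemma herm_uminus: "herm (- x) = - herm x"
  using herm_scale[of "-1" x] by simp

lemma herm_decomp: "v = herm v + smul \<i> (herm (smul (-\<i>) v))"
proof -
  have "smul \<i> (herm (smul (-\<i>) v)) = rsmul (1/2) (v - star v)"
    unfolding herm_def by (simp add: star_scale star_uminus scale_right_distrib scale_right_diff_distrib)
  then have "herm v + smul \<i> (herm (smul (-\<i>) v)) = rsmul (1/2) (v + star v + (v - star v))"
    unfolding herm_def by (simp only: scale_right_distrib)
  also have "v + star v + (v - star v) = v + v" by simp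
  finally show ?thesis by (simp only: double_half)
qed

lemma zero_in_P: "0 \<in> P"
  using cone_proper by blast

lemma star_P: "x \<in> P \<Longrightarrow> star x = x"
  using cone_hermitian unfolding hermitian_part_def by auto

lemma star_unit: "star e = e"
  using unit unfolding order_unit_def hermitian_part_def by auto

lemma order_unit_ge:
  assumes "star x = x"
  obtains r where "0 < r" "rsmul r e - x \<in> P"
  using unit assms unfolding order_unit_def hermitian_part_def cone_ge_def by blast

lemma unit_in_P: "e \<in> P"
proof -
  obtain r where r: "0 < r" "rsmul r e - 0 \<in> P" using order_unit_ge[of 0] by auto
  then have "rsmul (inverse r) (rsmul r e) \<in> P" by (intro cone_scale[of "inverse r"]) auto
  with r show ?thesis by simp
qed

text \<open>
  If \<open>-e\<close> were positive then \<open>e = 0\<close>, every hermitian element would be positive together with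
  its negative, and properness of the cone would force \<open>V = {0}\<close>.
\<close>

lemma uminus_unit_notin_P: "- e \<notin> P"
proof
  assume "- e \<in> P"
  then have "e \<in> P \<inter> uminus ` P" using unit_in_P by (auto intro!: image_eqI[where x = "- e"])
  then have e: "e = 0" using cone_proper by auto
  have P: "x \<in> P" if "star x = x" for x
    using order_unit_ge[of "- x"] that by (auto simp: star_uminus e)
  have "x = 0" if "star x = x" for x
  proof -
    have "x \<in> P \<inter> uminus ` P"
      using P[of x] P[of "- x"] that by (auto simp: star_uminus intro!: image_eqI[where x = "- x"])
    then show ?thesis using cone_proper by auto
  qed
  then have "herm v = 0" for v using star_herm by blast
  then have "v = 0" for v :: 'a by (subst herm_decomp) simp
  with nontrivial show False by auto
qed

lemma scale_unit_in_P_iff: "rsmul r e \<in> P \<longleftrightarrow> 0 \<le> r"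
proof
  assume *: "rsmul r e \<in> P"
  show "0 \<le> r"
  proof (rule ccontr)
    assume r: "\<not> 0 \<le> r"
    then have "rsmul (- inverse r) (rsmul r e) \<in> P"
      using * by (intro cone_scale[of "- inverse r" "rsmul r e"]) auto
    moreover have "rsmul (- inverse r) (rsmul r e) = - e"
      using r by simp
    ultimately show False using uminus_unit_notin_P by simp
  qed
qed (use cone_scale unit_in_P in auto)

lemma upper_bounds_nonempty: "upper_bounds v \<noteq> {}"
  using order_unit_ge[OF star_herm, of v] unfolding upper_bounds_def by blast

lemma upper_bounds_add:
  assumes "r \<in> upper_bounds v" "s \<in> upper_bounds w"
  shows "r + s \<in> upper_bounds (v + w)"
proof -
  have "(rsmul r e - herm v) + (rsmul s e - herm w) \<in> P"
    using assms unfolding upper_bounds_def by (intro cone_add) auto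
  then show ?thesis unfolding upper_bounds_def by (simp add: herm_add scale_left_distrib algebra_simps)
qed

lemma upper_bounds_scale:
  assumes "r \<in> upper_bounds v" "0 \<le> s"
  shows "s * r \<in> upper_bounds (rsmul s v)"
proof -
  have "rsmul s (rsmul r e - herm v) \<in> P"
    using assms unfolding upper_bounds_def by (intro cone_scale) auto
  then show ?thesis unfolding upper_bounds_def by (simp add: herm_scale scale_right_diff_distrib)
qed

lemma upper_bounds_zero: "upper_bounds 0 = {0..}"
  unfolding upper_bounds_def by (auto simp: scale_unit_in_P_iff)

lemma bdd_below_upper_bounds: "bdd_below (upper_bounds v)"
proof -
  obtain s where s: "s \<in> upper_bounds (- v)" using upper_bounds_nonempty by blast
  have "- s \<le> r" if "r \<in> upper_bounds v" for r
    using upper_bounds_add[OF that s] upper_bounds_zero by simp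
  then show ?thesis by (rule bdd_belowI)
qed

lemma gauge_le: "r \<in> upper_bounds v \<Longrightarrow> gauge v \<le> r"
  unfolding gauge_def by (intro cInf_lower bdd_below_upper_bounds)

lemma gauge_less_in_upper_bounds:
  assumes "gauge v < r"
  shows "r \<in> upper_bounds v"
proof -
  obtain s where s: "s \<in> upper_bounds v" "s < r"
    using assms cInf_lessD[OF upper_bounds_nonempty] unfolding gauge_def by blast
  have "r - s \<in> upper_bounds 0" using s upper_bounds_zero by simp
  from upper_bounds_add[OF s(1) this] show ?thesis by simp
qed

lemma sublinear_gauge: "sublinear rsmul gauge"
proof (rule sublinearI[OF vector_space_rsmul])
  show "gauge (x + y) \<le> gauge x + gauge y" for x y
    unfolding gauge_def[of x] gauge_def[of y]
    by (intro le_cInf_add upper_bounds_nonempty gauge_le upper_bounds_add)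
  show "gauge 0 = 0" unfolding gauge_def upper_bounds_zero by simp
  show "gauge (rsmul r x) \<le> r * gauge x" if "0 < r" for r x
    unfolding gauge_def[of x] using that
    by (intro le_mult_cInf upper_bounds_nonempty gauge_le upper_bounds_scale) auto
qed

lemma state_add: "state smul P e f \<Longrightarrow> f (x + y) = f x + f y"
  and state_scale: "state smul P e f \<Longrightarrow> f (smul c x) = c * f x"
  and state_unit: "state smul P e f \<Longrightarrow> f e = 1"
  and state_P: "state smul P e f \<Longrightarrow> x \<in> P \<Longrightarrow> f x \<in> \<real>\<^sub>\<ge>\<^sub>0"
  unfolding state_def Vector_Spaces.linear_iff by auto

lemma state_uminus: "state smul P e f \<Longrightarrow> f (- x) = - f x"
  using state_scale[of f "-1" x] by simp

lemma state_diff: "state smul P e f \<Longrightarrow> f (x - y) = f x - f y"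
  using state_add[of f x "- y"] state_uminus[of f y] by simp

text \<open>
  Complexification of a real functional dominated by the gauge. Positivity on \<open>p \<in> P\<close> comes from
  \<open>gauge (- p) \<le> 0\<close>, and \<open>g e = 1\<close> from \<open>gauge e \<le> 1\<close> and \<open>gauge (- e) \<le> -1\<close>.
\<close>

lemma state_dominated_by_gauge:
  fixes g :: "'a \<Rightarrow> real"
  assumes lin: "Vector_Spaces.linear rsmul (*) g" and le: "\<And>x. g x \<le> gauge x"
  shows "state smul P e (\<lambda>v. Complex (g v) (- g (smul \<i> v)))" (is "state _ _ _ ?f")
    and "star v = v \<Longrightarrow> Complex (g v) (- g (smul \<i> v)) = complex_of_real (g v)"
proof -
  have add: "g (x + y) = g x + g y" and scale: "g (rsmul r x) = r * g x" for x y r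
    using lin unfolding Vector_Spaces.linear_iff by auto
  have neg: "g (- x) = - g x" for x using scale[of "-1" x] by simp
  have gauge_zero: "gauge 0 = 0" by (rule sublinear_zero[OF vector_space_rsmul sublinear_gauge])
  have gauge_herm0: "gauge x = 0" if "herm x = 0" for x
    using that gauge_zero unfolding gauge_def upper_bounds_def by simp
  have g0: "g x = 0" if "herm x = 0" for x
    using le[of x] le[of "- x"] gauge_herm0[of x] gauge_herm0[of "- x"] that
    by (simp add: herm_uminus neg)
  \<comment> \<open>The hermitian part of \<open>\<i> x\<close> vanishes for hermitian \<open>x\<close>.\<close>
  have gi: "g (smul \<i> x) = 0" if "star x = x" for x
    using that by (intro g0) (simp add: herm_def star_scale)
  show real: "Complex (g v) (- g (smul \<i> v)) = complex_of_real (g v)" if "star v = v" for v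
    using gi[OF that] by (simp add: complex_eq_iff)
  have pos: "0 \<le> g p" if "p \<in> P" for p
  proof -
    have "0 \<in> upper_bounds (- p)"
      unfolding upper_bounds_def using that by (simp add: herm_uminus herm_hermitian star_P)
    from gauge_le[OF this] le[of "- p"] show ?thesis by (simp add: neg)
  qed
  have "1 \<in> upper_bounds e" "-1 \<in> upper_bounds (- e)"
    unfolding upper_bounds_def by (simp_all add: herm_uminus herm_hermitian star_unit zero_in_P)
  from this[THEN gauge_le] le[of e] le[of "- e"] have ge: "g e = 1" by (simp add: neg)
  have "?f (smul c v) = c * ?f v" for c v
  proof -
    have c: "smul c v = rsmul (Re c) v + rsmul (Im c) (smul \<i> v)"
      by (simp flip: scale_left_distrib) (simp add: complex_eq_iff)
    have "\<i> * c = complex_of_real (Re c) * \<i> + complex_of_real (- Im c)"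
      by (simp add: complex_eq_iff)
    then have ic: "smul \<i> (smul c v) = rsmul (Re c) (smul \<i> v) + rsmul (- Im c) v"
      by (simp only: scale_scale scale_left_distrib)
    show ?thesis
      unfolding ic unfolding c by (simp only: add scale) (simp add: complex_eq_iff)
  qed
  moreover have "?f (x + y) = ?f x + ?f y" for x y
    by (simp add: scale_right_distrib add complex_eq_iff)
  moreover have "vector_space ((*) :: complex \<Rightarrow> complex \<Rightarrow> complex)"
    by unfold_locales (simp_all add: algebra_simps)
  moreover have "?f p \<in> \<real>\<^sub>\<ge>\<^sub>0" if "p \<in> P" for p
    using real[OF star_P[OF that]] pos[OF that] by simp
  moreover have "?f e = 1" using real[OF star_unit] ge by simp
  ultimately show "state smul P e ?f"
    unfolding state_def Vector_Spaces.linear_iff using vector_space_axioms by blast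
qed

lemma exists_state_eq_gauge:
  assumes "star h = h"
  obtains f where "state smul P e f" "f h = complex_of_real (gauge h)"
proof -
  obtain g where "Vector_Spaces.linear rsmul (*) g" "\<And>x. g x \<le> gauge x" "g h = gauge h"
    using sublinear_dominates_linear[OF vector_space_rsmul sublinear_gauge] by blast
  then show thesis using state_dominated_by_gauge[of g] assms that by metis
qed

text \<open>A hermitian element is a difference of the two positive elements \<open>r e\<close> and \<open>r e - h\<close>.\<close>

lemma state_hermitian_real:
  assumes "state smul P e f" "star h = h"
  shows "Im (f h) = 0"
proof -
  obtain r where "rsmul r e - h \<in> P" using order_unit_ge[OF assms(2)] by blast
  from state_P[OF assms(1) this] show ?thesis
    by (simp add: state_diff[OF assms(1)] state_scale[OF assms(1)] state_unit[OF assms(1)]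
        complex_nonneg_Reals_iff)
qed

lemma state_star:
  assumes f: "state smul P e f"
  shows "f (star v) = cnj (f v)"
proof -
  have v: "f v = f (herm v) + \<i> * f (herm (smul (-\<i>) v))"
    by (subst (1) herm_decomp) (simp only: state_add[OF f] state_scale[OF f])
  have "herm (smul (-\<i>) (star v)) = - herm (smul (-\<i>) v)"
    using herm_star[of "smul (-\<i>) v"] by (simp add: star_scale star_uminus herm_uminus)
  then have "f (star v) = f (herm v) - \<i> * f (herm (smul (-\<i>) v))"
    by (subst herm_decomp) (simp only: state_add[OF f] state_scale[OF f] state_uminus[OF f] herm_star, simp)
  with v show ?thesis
    using state_hermitian_real[OF f star_herm, of v]
      state_hermitian_real[OF f star_herm, of "smul (-\<i>) v"]
    by (simp add: complex_eq_iff)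
qed

section \<open>The order seminorm and the minimal seminorm\<close>

lemma order_seminorm_hermitian:
  assumes "star h = h"
  shows "order_seminorm smul P e h = Inf (upper_bounds h \<inter> upper_bounds (- h))"
  unfolding order_seminorm_def upper_bounds_def cone_ge_def
  using assms by (intro arg_cong[of _ _ Inf]) (auto simp: herm_hermitian star_uminus)

text \<open>
  Any \<open>r\<close> strictly above both gauges is admissible in the infimum defining the order seminorm.
  The strictness matters: the cone need not be Archimedean, so the infima need not be attained.
\<close>

lemma order_seminorm_le_gauge:
  assumes "star h = h"
  shows "order_seminorm smul P e h \<le> max (gauge h) (gauge (- h))"
proof (rule dense_ge)
  fix r assume "max (gauge h) (gauge (- h)) < r"
  then have "r \<in> upper_bounds h \<inter> upper_bounds (- h)"
    by (auto intro: gauge_less_in_upper_bounds)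
  moreover have "bdd_below (upper_bounds h \<inter> upper_bounds (- h))"
    using bdd_below_upper_bounds[of h] by (rule bdd_below_mono) auto
  ultimately show "order_seminorm smul P e h \<le> r"
    unfolding order_seminorm_hermitian[OF assms] by (intro cInf_lower)
qed

lemma state_le_order_seminorm:
  assumes f: "state smul P e f" and h: "star h = h"
  shows "cmod (f h) \<le> order_seminorm smul P e h"
  unfolding order_seminorm_hermitian[OF h]
proof (rule cInf_greatest)
  have "max (gauge h) (gauge (- h)) + 1 \<in> upper_bounds h \<inter> upper_bounds (- h)"
    by (auto intro!: gauge_less_in_upper_bounds)
  then show "upper_bounds h \<inter> upper_bounds (- h) \<noteq> {}" by blast
next
  fix r assume "r \<in> upper_bounds h \<inter> upper_bounds (- h)"
  then have "rsmul r e - h \<in> P" "rsmul r e - (- h) \<in> P"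
    unfolding upper_bounds_def using h by (auto simp: herm_uminus herm_hermitian)
  from this[THEN state_P[OF f]] have "\<bar>Re (f h)\<bar> \<le> r"
    by (simp add: state_diff[OF f] state_add[OF f] state_scale[OF f] state_unit[OF f]
        complex_nonneg_Reals_iff abs_le_iff)
  with state_hermitian_real[OF f h] show "cmod (f h) \<le> r" by (simp add: cmod_eq_Re)
qed

lemma state_values_nonempty: "state_values smul P e v \<noteq> {}"
  using exists_state_eq_gauge[of 0] unfolding state_values_def by auto

lemma bdd_above_state_values: "bdd_above (state_values smul P e v)"
proof -
  let ?w = "herm (smul (-\<i>) v)"
  have "cmod (f v) \<le> order_seminorm smul P e (herm v) + order_seminorm smul P e ?w"
    if f: "state smul P e f" for f
  proof -
    have "f v = f (herm v) + \<i> * f ?w"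
      by (subst (1) herm_decomp) (simp only: state_add[OF f] state_scale[OF f])
    also have "cmod \<dots> \<le> cmod (f (herm v)) + cmod (\<i> * f ?w)" by (rule norm_triangle_ineq)
    finally show ?thesis
      using state_le_order_seminorm[OF f star_herm, of v]
        state_le_order_seminorm[OF f star_herm, of "smul (-\<i>) v"]
      by (simp add: norm_mult)
  qed
  then show ?thesis unfolding state_values_def
    by (intro bdd_aboveI[where M = "order_seminorm smul P e (herm v) + order_seminorm smul P e ?w"]) blast
qed

lemma state_le_minimal_seminorm:
  "state smul P e f \<Longrightarrow> cmod (f v) \<le> minimal_seminorm smul P e v"
  unfolding minimal_seminorm_def
  by (intro cSup_upper bdd_above_state_values) (auto simp: state_values_def)

lemma minimal_seminorm_le:
  assumes "\<And>f. state smul P e f \<Longrightarrow> cmod (f v) \<le> b"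
  shows "minimal_seminorm smul P e v \<le> b"
  unfolding minimal_seminorm_def
  using assms by (intro cSup_least state_values_nonempty) (auto simp: state_values_def)

lemma star_seminorm_minimal_seminorm: "star_seminorm smul star (minimal_seminorm smul P e)"
  unfolding star_seminorm_def
proof (intro conjI allI)
  let ?N = "minimal_seminorm smul P e"
  show "0 \<le> ?N v" for v
  proof -
    obtain f where "state smul P e f" using exists_state_eq_gauge[of 0] by auto
    from state_le_minimal_seminorm[OF this, of v] show ?thesis
      by (rule order_trans[OF norm_ge_zero])
  qed
  show "?N (v + w) \<le> ?N v + ?N w" for v w
  proof (rule minimal_seminorm_le)
    fix f assume f: "state smul P e f"
    have "cmod (f (v + w)) \<le> cmod (f v) + cmod (f w)"
      unfolding state_add[OF f] by (rule norm_triangle_ineq)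
    also have "\<dots> \<le> ?N v + ?N w"
      by (intro add_mono state_le_minimal_seminorm f)
    finally show "cmod (f (v + w)) \<le> ?N v + ?N w" .
  qed
  have scale_le: "?N (smul c v) \<le> cmod c * ?N v" for c v
    by (rule minimal_seminorm_le)
      (simp add: state_scale norm_mult mult_left_mono state_le_minimal_seminorm)
  show "?N (smul c v) = cmod c * ?N v" for c v
  proof (cases "c = 0")
    case True
    have "?N 0 \<le> 0" using scale_le[of 0 0] by simp
    with True \<open>\<And>v. 0 \<le> ?N v\<close>[of 0] show ?thesis by simp
  next
    case False
    \<comment> \<open>The reverse inequality is \<open>scale_le\<close> for the inverse scalar.\<close>
    with scale_le[of "inverse c" "smul c v"] have "?N v \<le> inverse (cmod c) * ?N (smul c v)"
      by (simp add: norm_inverse)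
    with False have "cmod c * ?N v \<le> ?N (smul c v)" by (simp add: field_simps)
    with scale_le[of c v] show ?thesis by simp
  qed
  have "cmod (f (star v)) = cmod (f v)" if "state smul P e f" for f v
    by (simp add: state_star[OF that])
  then have "state_values smul P e (star v) = state_values smul P e v" for v
    unfolding state_values_def by metis
  then show "?N (star v) = ?N v" for v
    by (simp add: minimal_seminorm_def)
qed

lemma minimal_seminorm_hermitian:
  assumes h: "star h = h"
  shows "minimal_seminorm smul P e h = order_seminorm smul P e h"
proof (rule antisym)
  show "minimal_seminorm smul P e h \<le> order_seminorm smul P e h"
    by (intro minimal_seminorm_le state_le_order_seminorm h)
  have "gauge h \<le> minimal_seminorm smul P e h"
  proof -
    obtain f where "state smul P e f" "f h = complex_of_real (gauge h)"
      using exists_state_eq_gauge[OF h] .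
    then show ?thesis using state_le_minimal_seminorm[of f h] by simp
  qed
  moreover have "gauge (- h) \<le> minimal_seminorm smul P e h"
  proof -
    have "star (- h) = - h" using h by (simp add: star_uminus)
    then obtain f where f: "state smul P e f" "f (- h) = complex_of_real (gauge (- h))"
      using exists_state_eq_gauge by blast
    then have "cmod (f h) = \<bar>gauge (- h)\<bar>"
      by (metis norm_minus_cancel norm_of_real state_uminus)
    then show ?thesis using state_le_minimal_seminorm[OF f(1), of h] by simp
  qed
  ultimately show "order_seminorm smul P e h \<le> minimal_seminorm smul P e h"
    using order_seminorm_le_gauge[OF h] by simp
qed

lemma minimal_seminorm_minimal:
  assumes N: "star_seminorm smul star N"
    and ext: "\<And>h. star h = h \<Longrightarrow> N h = order_seminorm smul P e h"
  shows "minimal_seminorm smul P e v \<le> N v"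
proof (rule minimal_seminorm_le)
  fix f assume f: "state smul P e f"
  \<comment> \<open>Rotate \<open>v\<close> so that its value under \<open>f\<close> is a nonnegative real.\<close>
  obtain c where c: "cmod c = 1" "c * f v = complex_of_real (cmod (f v))"
  proof (cases "f v = 0")
    case False
    then have "cmod (cnj (f v) / complex_of_real (cmod (f v))) = 1" by (simp add: norm_divide)
    moreover have "cnj (f v) / complex_of_real (cmod (f v)) * f v = complex_of_real (cmod (f v))"
      using False complex_norm_square[of "f v"] by (simp add: power2_eq_square field_simps)
    ultimately show thesis by (rule that)
  qed (use that[of 1] in simp)
  define w where "w = smul c v"
  have fw: "f w = complex_of_real (cmod (f v))" unfolding w_def by (simp add: state_scale[OF f] c)
  have "f (herm w) = f w"
    unfolding herm_def by (simp add: state_scale[OF f] state_add[OF f] state_star[OF f] fw)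
  then have "cmod (f v) = cmod (f (herm w))" using fw by simp
  also have "\<dots> \<le> N (herm w)"
    using state_le_order_seminorm[OF f star_herm] ext[OF star_herm] by simp
  also have "\<dots> = 1/2 * N (w + star w)"
  proof -
    have "N (smul d x) = cmod d * N x" for d x using N unfolding star_seminorm_def by blast
    then show ?thesis unfolding herm_def by (simp add: norm_divide)
  qed
  also have "\<dots> \<le> 1/2 * (N w + N (star w))"
  proof -
    have "N (w + star w) \<le> N w + N (star w)" using N unfolding star_seminorm_def by blast
    then show ?thesis by simp
  qed
  also have "\<dots> = N w" using N unfolding star_seminorm_def by simp
  also have "\<dots> = N v" using N c(1) unfolding star_seminorm_def w_def by simp
  finally show "cmod (f v) \<le> N v" .
qed

end

theorem theorem4p5:
  fixes smul :: "complex \<Rightarrow> 'a::ab_group_add \<Rightarrow> 'a"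
    and star :: "'a \<Rightarrow> 'a" and P :: "'a set" and e :: 'a
  assumes "ordered_star_vector_space smul star P"
    and "order_unit smul star P e"
    and "(UNIV :: 'a set) \<noteq> {0}"
  shows "(\<forall>v. state_values smul P e v \<noteq> {} \<and> bdd_above (state_values smul P e v)) \<and>
    star_seminorm smul star (minimal_seminorm smul P e) \<and>
    (\<forall>v \<in> hermitian_part star. minimal_seminorm smul P e v = order_seminorm smul P e v) \<and>
    (\<forall>N. star_seminorm smul star N \<and>
         (\<forall>v \<in> hermitian_part star. N v = order_seminorm smul P e v) \<longrightarrow>
         (\<forall>v. minimal_seminorm smul P e v \<le> N v))"
proof -
  interpret order_unit_space smul star P e
    using assms by (intro order_unit_space.intro order_unit_space_axioms.intro)
  show ?thesis
    using state_values_nonempty bdd_above_state_values star_seminorm_minimal_seminorm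
      minimal_seminorm_hermitian minimal_seminorm_minimal
    by (simp add: hermitian_part_def)
qed

end
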